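(* Let $p>2$. Let $\mathcal V:\mathbb R\to\mathbb R$ be a $C^2$ function for which there are $A,B\in\mathbb R$ with $0<A<B$ and $E_*>0$ such that $\mathcal V(0)=\mathcal V(B)=E_*$, $\mathcal V'(0)=\mathcal V(A)=\mathcal V'(A)=0$, $\mathcal V''(A)>0$, and $0<\mathcal V(w)<E_*$ for all $w\in(0,A)\cup(A,B)$. Assume that $\mathcal V$ is of class $C^3$ on $\mathbb R^+$. For $E\in(0,E_* )$, let $T(E)$ be the minimal period of the positive periodic solutions with energy $E$ of $(|w'|^{p-2}w')'+\mathcal V'(w)=0$ that surround the equilibrium $(w,w')=(A,0)$. If $\mathcal V/(\mathcal V')^2$ is a (well-defined, finite) convex function on $(0,B)$, its value at $w=A$ being its limit $1/(2\,\mathcal V''(A))$ (in particular $\mathcal V'\neq0$ on $(0,A)\cup(A,B)$), then $E\mapsto T(E)$ is increasing on $(0,E_* )$.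
   Context: Here $p'=p/(p-1)$. The energy $E=\frac1{p'}|w'|^p+\mathcal V(w)$ is constant along solutions of $(|w'|^{p-2}w')'+\mathcal V'(w)=0$. For $E\in(0,E_* )$, let $w_1(E)<w_2(E)$ be the two roots of $\mathcal V(w)=E$ such that $0<w_1(E)<A<w_2(E)<B$ and $\mathcal V(w)<E$ for all $w\in(w_1(E),w_2(E))$. The periodic solutions considered are those with energy $E$ oscillating between $w_1(E)$ and $w_2(E)$; their minimal period is $$T(E)=\frac{2}{(p')^{1/p}}\int_{w_1(E)}^{w_2(E)}\frac{dw}{(E-\mathcal V(w))^{1/p}}.$$ *)

theory Defs
  imports "HOL-Analysis.Analysis" "HOL-Library.Periodic_Fun"
begin

text \<open>Class \<open>C\<^sup>k\<close> on a set of reals; only meant for open sets, since the two-sided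
  \<^const>\<open>deriv\<close> is used.\<close>

definition Ck_on :: "nat \<Rightarrow> (real \<Rightarrow> real) \<Rightarrow> real set \<Rightarrow> bool" where
  "Ck_on k f S \<longleftrightarrow>
     (\<forall>j<k. \<forall>x\<in>S. (deriv ^^ j) f field_differentiable (at x)) \<and>
     (\<forall>j\<le>k. continuous_on S ((deriv ^^ j) f))"

text \<open>Global classical solutions of \<open>(|w'|\<^bsup>p-2\<^esup> w')' + V'(w) = 0\<close>: both \<open>w\<close> and the flux
  \<open>|w'|\<^bsup>p-2\<^esup> w'\<close> are differentiable. For \<open>p > 2\<close> the flux is a homeomorphic
  function of \<open>w'\<close>, so \<open>w\<close> is then automatically \<open>C\<^sup>1\<close>, but in general not \<open>C\<^sup>2\<close>.\<close>

definition plaplace_flux :: "real \<Rightarrow> (real \<Rightarrow> real) \<Rightarrow> real \<Rightarrow> real" where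
  "plaplace_flux p w t = \<bar>deriv w t\<bar> powr (p - 2) * deriv w t"

definition plaplace_solution :: "real \<Rightarrow> (real \<Rightarrow> real) \<Rightarrow> (real \<Rightarrow> real) \<Rightarrow> bool" where
  "plaplace_solution p V w \<longleftrightarrow>
     (\<forall>t. w field_differentiable (at t)) \<and>
     (\<forall>t. plaplace_flux p w field_differentiable (at t)) \<and>
     (\<forall>t. deriv (plaplace_flux p w) t + deriv V (w t) = 0)"

definition conj_exp :: "real \<Rightarrow> real" where
  "conj_exp p = p / (p - 1)"

definition has_energy :: "real \<Rightarrow> (real \<Rightarrow> real) \<Rightarrow> (real \<Rightarrow> real) \<Rightarrow> real \<Rightarrow> bool" where
  "has_energy p V w E \<longleftrightarrow>
     (\<forall>t. 1 / conj_exp p * \<bar>deriv w t\<bar> powr p + V (w t) = E)"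

text \<open>At energy \<open>E\<close>, surrounding the equilibrium \<open>(A, 0)\<close> means oscillating between the two
  roots \<open>w\<^sub>1 < A < w\<^sub>2\<close> of \<open>V = E\<close> that delimit the potential well around \<open>A\<close>.\<close>

definition oscillates_in_well ::
  "(real \<Rightarrow> real) \<Rightarrow> real \<Rightarrow> real \<Rightarrow> real \<Rightarrow> (real \<Rightarrow> real) \<Rightarrow> bool" where
  "oscillates_in_well V A B E w \<longleftrightarrow>
     (\<exists>w1 w2. 0 < w1 \<and> w1 < A \<and> A < w2 \<and> w2 < B \<and> V w1 = E \<and> V w2 = E \<and>
              (\<forall>x\<in>{w1<..<w2}. V x < E) \<and> range w = {w1..w2})"

definition is_minimal_period :: "(real \<Rightarrow> real) \<Rightarrow> real \<Rightarrow> bool" where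
  "is_minimal_period w T \<longleftrightarrow>
     0 < T \<and> periodic_fun_simple w T \<and> (\<forall>S>0. periodic_fun_simple w S \<longrightarrow> T \<le> S)"

text \<open>The common minimal period of the positive periodic solutions of energy \<open>E\<close> surrounding
  \<open>(A, 0)\<close>. The description is proper exactly if such solutions exist and all have the
  same minimal period.\<close>

definition min_period ::
  "real \<Rightarrow> (real \<Rightarrow> real) \<Rightarrow> real \<Rightarrow> real \<Rightarrow> real \<Rightarrow> real" where
  "min_period p V A B E =
     (THE T. \<exists>w. plaplace_solution p V w \<and> has_energy p V w E \<and> (\<forall>t. 0 < w t) \<and>
                 oscillates_in_well V A B E w \<and> is_minimal_period w T)"

end

theory Submission
  imports Defs
begin

text \<open>
  Put \<open>G = V / V'\<^sup>2\<close>, \<open>h(x) = sgn (x - A) \<surd>V(x)\<close>, \<open>\<xi> = h\<^sup>-\<^sup>1\<close> and \<open>q = \<surd>G \<circ> \<xi>\<close>.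
  Since \<open>h' = 1 / (2\<surd>G)\<close>, the substitution \<open>w = \<xi>(\<surd>E sin \<theta>)\<close> turns the period into
  \<open>T(E) = 4 p'\<^bsup>-1/p\<^esup> E\<^bsup>1/2-1/p\<^esup> \<integral> q(\<surd>E sin \<theta>) cos\<^bsup>1-2/p\<^esup> \<theta> d\<theta>\<close>
  over \<open>[-\<pi>/2, \<pi>/2]\<close>. As \<open>\<xi>' = 2q\<close>, the derivative of \<open>q(y) + q(-y)\<close> is
  \<open>G'(\<xi>(y)) - G'(\<xi>(-y)) \<ge> 0\<close>, so the integral is nondecreasing in \<open>E\<close>, and the power
  of \<open>E\<close> is strictly increasing because \<open>p > 2\<close>.

  If \<open>\<tau>\<close> is the travel time from \<open>w\<^sub>1\<close>, then \<open>\<tau> \<circ> w\<close> is a triangle wave of slope \<open>\<plusminus>1\<close> for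
  every admissible solution \<open>w\<close>: the flux has a nonzero derivative at the turning points, so the
  solution cannot rest there. This gives the minimal period; conversely
  the inverse of \<open>\<tau>\<close> applied to a triangle wave is a solution.
\<close>

section \<open>Triangle waves\<close>

text \<open>L'Hopital applied to the difference quotient. It supplies derivatives at the exceptional
  points where the chain rule breaks down: the turning times of an orbit and the bottom
  \<open>A\<close> of the well.\<close>

lemma DERIV_limit_at_point:
  fixes f g :: "real \<Rightarrow> real"
  assumes "isCont f c" and ev: "eventually (\<lambda>x. (f has_real_derivative g x) (at x)) (at c)"
    and "(g \<longlongrightarrow> l) (at c)"
  shows "(f has_real_derivative l) (at c)"
proof -
  have "((\<lambda>x. (f x - f c) / (x - c)) \<longlongrightarrow> l) (at c)"
  proof (rule lhopital[where f' = g and g' = "\<lambda>_. 1"])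
    show "((\<lambda>x. f x - f c) \<longlongrightarrow> 0) (at c)"
      using assms(1) by (simp add: isCont_def LIM_zero)
    show "((\<lambda>x. x - c) \<longlongrightarrow> 0) (at c)"
      by (simp add: LIM_zero)
    show "\<forall>\<^sub>F x in at c. x - c \<noteq> 0"
      by (auto simp: eventually_at_filter)
    show "\<forall>\<^sub>F x in at c. ((\<lambda>x. f x - f c) has_real_derivative g x) (at x)"
      using ev by eventually_elim (auto intro!: derivative_eq_intros)
    show "\<forall>\<^sub>F x in at c. ((\<lambda>x. x - c) has_real_derivative 1) (at x)"
      by (intro always_eventually allI) (auto intro!: derivative_eq_intros)
  qed (use assms(3) in simp_all)
  then show ?thesis
    by (simp add: has_field_derivative_iff)
qed

text \<open>In the application \<open>y\<close> is the travel time along a solution and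
  \<open>f\<close> its flux, whose sign gives the direction of motion. \<open>f_up\<close> and
  \<open>f_down\<close> make the flux leave zero at a turning point, which rules out resting
  there.\<close>

locale zigzag =
  fixes a b :: real and y f :: "real \<Rightarrow> real"
  assumes ab: "a < b"
    and y_bounds: "a \<le> y t" "y t \<le> b"
    and y_cont: "isCont y t" and f_cont: "isCont f t"
    and f_zero: "f t = 0 \<longleftrightarrow> y t = a \<or> y t = b"
    and y_up: "f t > 0 \<Longrightarrow> (y has_real_derivative 1) (at t)"
    and y_down: "f t < 0 \<Longrightarrow> (y has_real_derivative -1) (at t)"
    and f_up: "y t = a \<Longrightarrow> \<exists>D>0. (f has_real_derivative D) (at t)"
    and f_down: "y t = b \<Longrightarrow> \<exists>D<0. (f has_real_derivative D) (at t)"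
begin

text \<open>Time reversal transfers statements about later times to earlier ones.\<close>

lemma zigzag_reverse: "zigzag a b (\<lambda>t. y (- t)) (\<lambda>t. - f (- t))"
proof
  fix t :: real
  show "a < b" by (rule ab)
  show "a \<le> y (- t)" "y (- t) \<le> b" by (rule y_bounds)+
  show "isCont (\<lambda>t. y (- t)) t"
    by (rule isCont_o2[OF _ y_cont]) simp
  show "isCont (\<lambda>t. - f (- t)) t"
    by (intro continuous_minus isCont_o2[OF _ f_cont]) simp
  show "(- f (- t) = 0) = (y (- t) = a \<or> y (- t) = b)"
    using f_zero by simp
  have u: "(uminus has_real_derivative -1) (at t)"
    by (auto intro!: derivative_eq_intros)
  show "((\<lambda>t. y (- t)) has_real_derivative 1) (at t)" if "- f (- t) > 0"
    using DERIV_chain2[OF y_down u] that by simp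
  show "((\<lambda>t. y (- t)) has_real_derivative -1) (at t)" if "- f (- t) < 0"
    using DERIV_chain2[OF y_up u] that by simp
  have flip: "((\<lambda>t. - f (- t)) has_real_derivative D) (at t)" if "(f has_real_derivative D) (at (- t))" for D
    using DERIV_minus[OF DERIV_chain2[OF that u]] by simp
  show "\<exists>D>0. ((\<lambda>t. - f (- t)) has_real_derivative D) (at t)" if t: "y (- t) = a"
  proof -
    obtain D where "D > 0" "(f has_real_derivative D) (at (- t))" using f_up t by auto
    then show ?thesis by (intro exI[of _ D]) (auto intro: flip)
  qed
  show "\<exists>D<0. ((\<lambda>t. - f (- t)) has_real_derivative D) (at t)" if t: "y (- t) = b"
  proof -
    obtain D where "D < 0" "(f has_real_derivative D) (at (- t))" using f_down t by auto
    then show ?thesis by (intro exI[of _ D]) (auto intro: flip)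
  qed
qed

text \<open>Reflection exchanges the two ends, so that falling is an instance of rising.\<close>

lemma zigzag_negate: "zigzag (- b) (- a) (\<lambda>t. - y t) (\<lambda>t. - f t)"
proof
  fix t :: real
  show "- b < - a" "- b \<le> - y t" "- y t \<le> - a" using ab y_bounds by auto
  show "isCont (\<lambda>t. - y t) t" "isCont (\<lambda>t. - f t) t"
    by (intro continuous_minus y_cont f_cont)+
  show "(- f t = 0) = (- y t = - b \<or> - y t = - a)"
    using f_zero by auto
  show "((\<lambda>t. - y t) has_real_derivative 1) (at t)" if "- f t > 0"
    using DERIV_minus[OF y_down] that by simp
  show "((\<lambda>t. - y t) has_real_derivative -1) (at t)" if "- f t < 0"
    using DERIV_minus[OF y_up] that by simp
  show "\<exists>D>0. ((\<lambda>t. - f t) has_real_derivative D) (at t)" if t: "- y t = - b"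
  proof -
    obtain D where "D < 0" "(f has_real_derivative D) (at t)" using f_down t by auto
    then show ?thesis by (intro exI[of _ "- D"]) (auto intro: DERIV_minus)
  qed
  show "\<exists>D<0. ((\<lambda>t. - f t) has_real_derivative D) (at t)" if t: "- y t = - a"
  proof -
    obtain D where "D > 0" "(f has_real_derivative D) (at t)" using f_up t by auto
    then show ?thesis by (intro exI[of _ "- D"]) (auto intro: DERIV_minus)
  qed
qed

text \<open>By the mean value theorem only the slope in the open interval matters, so
  \<open>f\<close> may vanish at both ends.\<close>

lemma rise_while_positive:
  assumes "t0 \<le> t1" and pos: "\<And>t. t0 < t \<Longrightarrow> t < t1 \<Longrightarrow> f t > 0"
  shows "y t1 = y t0 + (t1 - t0)"
proof (cases "t0 = t1")
  case False
  with assms have "t0 < t1" by simp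
  moreover have "continuous_on {t0..t1} y"
    using y_cont by (simp add: continuous_at_imp_continuous_on)
  moreover have "y differentiable (at t)" if "t0 < t" "t < t1" for t
    using y_up[OF pos[OF that]] by (auto simp: real_differentiable_def)
  ultimately obtain l z where z: "t0 < z" "z < t1" "(y has_real_derivative l) (at z)"
    and eq: "y t1 - y t0 = (t1 - t0) * l"
    using MVT[of t0 t1 y] by auto
  have "l = 1" using DERIV_unique[OF z(3) y_up[OF pos[OF z(1,2)]]] .
  with eq show ?thesis by simp
qed simp

text \<open>The positive derivative of \<open>f\<close> at \<open>t0\<close> starts the ascent. If
  it stopped too early, then at the first later zero of \<open>f\<close> the value of
  \<open>y\<close> would lie strictly between \<open>a\<close> and \<open>b\<close>, contradicting
  \<open>f_zero\<close>.\<close>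

lemma rise:
  assumes y0: "y t0 = a" and "0 \<le> s" "s \<le> b - a"
  shows "y (t0 + s) = a + s"
proof -
  have pos: "f t > 0" if t: "t0 < t" "t < t0 + s" for t
  proof (rule ccontr)
    assume nonpos: "\<not> f t > 0"
    have f0: "f t0 = 0" using f_zero y0 by simp
    obtain D where "D > 0" "(f has_real_derivative D) (at t0)" using f_up[OF y0] by blast
    then obtain d where d: "d > 0" "\<And>h. h > 0 \<Longrightarrow> h < d \<Longrightarrow> f t0 < f (t0 + h)"
      using DERIV_pos_inc_right by blast
    have pos0: "f r > 0" if "t0 < r" "r < t0 + d" for r
      using d(2)[of "r - t0"] that f0 by simp
    have "t \<ge> t0 + d" using nonpos pos0[of t] t by force
    \<comment> \<open>Zeros are sought only from \<open>m\<close> on, which keeps the trivial zero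
      \<open>t0\<close> out of \<open>Z\<close>.\<close>
    define m where "m = t0 + d / 2"
    have m: "t0 < m" "m < t" "f m > 0"
      using \<open>t \<ge> t0 + d\<close> d(1) pos0[of m] by (auto simp: m_def)
    define Z where "Z = {r \<in> {m..t}. f r = 0}"
    have "continuous_on {m..t} f"
      using f_cont by (simp add: continuous_at_imp_continuous_on)
    then have "closed Z"
      unfolding Z_def by (rule continuous_closed_preimage_constant) simp
    then have "compact Z"
      using bounded_subset[OF bounded_closed_interval, of Z m t]
      by (simp add: compact_eq_bounded_closed Z_def subset_iff)
    moreover have "Z \<noteq> {}"
      using IVT2'[of f t 0 m] \<open>continuous_on {m..t} f\<close> m nonpos by (auto simp: Z_def)
    ultimately obtain t1 where t1: "t1 \<in> Z" "\<And>r. r \<in> Z \<Longrightarrow> t1 \<le> r"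
      using compact_attains_inf[of Z] by auto
    \<comment> \<open>Up to \<open>m\<close> this is \<open>pos0\<close>; beyond \<open>m\<close>,
      the intermediate value theorem would give a zero before the first one.\<close>
    have "f r > 0" if r: "t0 < r" "r < t1" for r
    proof (rule ccontr)
      assume neg: "\<not> f r > 0"
      then have "m < r" using r pos0[of r] d(1) by (force simp: m_def)
      then obtain z where "m \<le> z" "z \<le> r" "f z = 0"
        using IVT2'[of f r 0 m] m neg f_cont by (auto simp: continuous_at_imp_continuous_on)
      then have "z \<in> Z" using r t1(1) by (auto simp: Z_def)
      then show False using t1(2)[of z] r \<open>z \<le> r\<close> by simp
    qed
    then have "y t1 = a + (t1 - t0)"
      using rise_while_positive[of t0 t1] t1(1) m(1) y0 by (auto simp: Z_def)
    moreover have "t0 < t1" "t1 < t0 + s" "f t1 = 0" using t1(1) m(1) t by (auto simp: Z_def)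
    ultimately show False using f_zero[of t1] assms by auto
  qed
  show ?thesis
    using rise_while_positive[of t0 "t0 + s"] pos assms by auto
qed

lemma fall:
  assumes "y t0 = b" and "0 \<le> s" "s \<le> b - a"
  shows "y (t0 + s) = b - s"
  using zigzag.rise[OF zigzag_negate, of t0 s] assms by simp

lemma period_step:
  assumes "y t0 = a"
  shows "y (t0 + 2 * (b - a)) = a"
proof -
  have "y (t0 + (b - a)) = b" using rise[OF assms, of "b - a"] ab by simp
  from fall[OF this, of "b - a"] ab show ?thesis by (simp add: algebra_simps)
qed

text \<open>Induction over the integers in both directions; the downward step is a forward step of
  the reversed zigzag.\<close>

lemma period_steps:
  assumes "y t0 = a"
  shows "y (t0 + of_int n * (2 * (b - a))) = a"
proof (induction n rule: int_induct[of _ 0])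
  case base
  then show ?case using assms by simp
next
  case (step1 i)
  then show ?case using period_step[of "t0 + of_int i * (2 * (b - a))"] by (simp add: algebra_simps)
next
  case (step2 i)
  then show ?case
    using zigzag.period_step[OF zigzag_reverse, of "- (t0 + of_int i * (2 * (b - a)))"]
    by (simp add: algebra_simps)
qed

text \<open>One rise followed by one fall. The range of \<open>s\<close> is half-open so that the
  value \<open>a\<close> occurs only at \<open>s = 0\<close>, which is what minimality of the period
  rests on.\<close>

lemma cycle:
  assumes y0: "y t0 = a" and "0 \<le> s" "s < 2 * (b - a)"
  shows "y (t0 + s) = (if s \<le> b - a then a + s else 2 * b - a - s)"
proof (cases "s \<le> b - a")
  case False
  have "y (t0 + (b - a)) = b" using rise[OF y0, of "b - a"] ab by simp
  from fall[OF this, of "s - (b - a)"] False assms show ?thesis by simp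
qed (use rise[OF y0, of s] assms in simp)

lemma minimal_period:
  assumes y0: "y t0 = a"
  shows "is_minimal_period y (2 * (b - a))"
  unfolding is_minimal_period_def
proof (intro conjI allI impI)
  let ?T = "2 * (b - a)"
  show "0 < ?T" using ab by simp
  show "periodic_fun_simple y ?T"
  proof
    fix t
    \<comment> \<open>The number of whole cycles between \<open>t0\<close> and \<open>t\<close>;
      then \<open>c\<close> is a lower turning time and \<open>t - c\<close> is in the range covered
      by \<open>cycle\<close>.\<close>
    define n where "n = \<lfloor>(t - t0) / ?T\<rfloor>"
    define c where "c = t0 + of_int n * ?T"
    have c: "y c = a" unfolding c_def by (rule period_steps[OF y0])
    have "of_int n \<le> (t - t0) / ?T" "(t - t0) / ?T < of_int n + 1" 
      unfolding n_def by linarith+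
    then have "0 \<le> t - c" "t - c < ?T"
      using ab unfolding c_def by (simp_all add: field_simps)
    from cycle[OF c this] cycle[OF period_step[OF c] this]
    have "y (c + ?T + (t - c)) = y (c + (t - c))" by (simp only:)
    then show "y (t + ?T) = y t" by (simp add: add.commute)
  qed
  fix S :: real
  assume "S > 0" "periodic_fun_simple y S"
  then have "y (t0 + S) = a"
    using y0 periodic_fun_simple.plus_period[of y S t0] by simp
  show "?T \<le> S"
  proof (rule ccontr)
    assume "\<not> ?T \<le> S"
    \<comment> \<open>The explicit formula takes the value \<open>a\<close> at no time strictly
      between \<open>0\<close> and \<open>2 * (b - a)\<close>.\<close>
    then show False
      using cycle[OF y0, of S] \<open>y (t0 + S) = a\<close> \<open>S > 0\<close> by (simp split: if_splits)
  qed
qed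

end

section \<open>Solutions from the travel time\<close>

lemma conj_exp_pos: "p > 1 \<Longrightarrow> conj_exp p > 0"
  by (simp add: conj_exp_def)

text \<open>\<open>\<tau>\<close> is the time that a solution of energy \<open>E\<close> needs to travel up to a given position.\<close>

locale time_map =
  fixes p E w1 w2 :: real and V \<tau> :: "real \<Rightarrow> real"
  assumes p: "p > 1"
    and V_deriv: "(V has_real_derivative deriv V x) (at x)"
    and dV_cont: "isCont (deriv V) x"
    and w12: "w1 < w2" and V_ends: "V w1 = E" "V w2 = E"
    and V_less: "w1 < x \<Longrightarrow> x < w2 \<Longrightarrow> V x < E"
    and dV_ends: "deriv V w1 < 0" "deriv V w2 > 0"
    and \<tau>_cont: "continuous_on {w1..w2} \<tau>"
    and \<tau>_deriv: "w1 < x \<Longrightarrow> x < w2 \<Longrightarrow>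
      (\<tau> has_real_derivative 1 / (conj_exp p * (E - V x)) powr (1 / p)) (at x)"
begin

text \<open>The value of |w'| at position \<open>x\<close>, obtained by solving the energy identity
  for it.\<close>

definition speed :: "real \<Rightarrow> real" where
  "speed x = (conj_exp p * (E - V x)) powr (1 / p)"

text \<open>Half of the period: the time for one passage from \<open>w1\<close> to
  \<open>w2\<close>.\<close>

definition L :: real where
  "L = \<tau> w2 - \<tau> w1"

lemma speed_pos: "w1 < x \<Longrightarrow> x < w2 \<Longrightarrow> speed x > 0"
  using V_less[of x] conj_exp_pos[OF p] by (simp add: speed_def)

lemma speed_ends [simp]: "speed w1 = 0" "speed w2 = 0"
  by (simp_all add: speed_def V_ends)

lemma V_le: "x \<in> {w1..w2} \<Longrightarrow> V x \<le> E"
  using V_less[of x] V_ends by (cases "x = w1 \<or> x = w2") auto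

lemma V_cont: "continuous_on S V"
  using DERIV_isCont[OF V_deriv] by (simp add: continuous_at_imp_continuous_on)

lemma speed_cont: "continuous_on {w1..w2} speed"
  unfolding speed_def using V_le p conj_exp_pos[OF p]
  by (intro continuous_on_powr' continuous_intros V_cont) auto

lemma \<tau>_strict_mono:
  assumes "w1 \<le> x" "x < z" "z \<le> w2"
  shows "\<tau> x < \<tau> z"
proof (rule DERIV_pos_imp_increasing_open[OF assms(2)])
  show "\<exists>y. (\<tau> has_real_derivative y) (at u) \<and> 0 < y" if "x < u" "u < z" for u
    using \<tau>_deriv[of u] speed_pos[of u] that assms unfolding speed_def by auto
  show "continuous_on {x..z} \<tau>"
    using \<tau>_cont assms by (rule_tac continuous_on_subset) auto
qed

lemma L_pos: "L > 0"
  using \<tau>_strict_mono[of w1 w2] w12 by (simp add: L_def)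

lemma \<tau>_inj: "inj_on \<tau> {w1..w2}"
  by (rule linorder_inj_onI) (use \<tau>_strict_mono in \<open>force+\<close>)

lemma \<tau>_image: "\<tau> ` {w1..w2} = {\<tau> w1..\<tau> w2}"
proof
  show "\<tau> ` {w1..w2} \<subseteq> {\<tau> w1..\<tau> w2}"
  proof
    fix y assume "y \<in> \<tau> ` {w1..w2}"
    then obtain x where "x \<in> {w1..w2}" "y = \<tau> x" by auto
    then show "y \<in> {\<tau> w1..\<tau> w2}"
      using \<tau>_strict_mono[of w1 x] \<tau>_strict_mono[of x w2]
      by (cases "x = w1"; cases "x = w2") auto
  qed
  show "{\<tau> w1..\<tau> w2} \<subseteq> \<tau> ` {w1..w2}"
  proof
    fix y assume "y \<in> {\<tau> w1..\<tau> w2}"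
    then obtain x where "w1 \<le> x" "x \<le> w2" "\<tau> x = y"
      using IVT'[of \<tau> w1 y w2] w12 \<tau>_cont by auto
    then show "y \<in> \<tau> ` {w1..w2}" by force
  qed
qed

section \<open>Every solution sweeping the interval is a zigzag in travel time\<close>

lemma flux_sgn: "sgn (plaplace_flux p w t) = sgn (deriv w t)"
  by (cases "deriv w t = 0") (simp_all add: plaplace_flux_def sgn_mult)

text \<open>Since \<tau>' is 1/\<open>speed\<close> and |w'| equals \<open>speed (w t)\<close>, the
  derivative of \<tau>(w(t)) is the sign of w'. The equation gives the flux the derivative -V'(w),
  which is positive at \<open>w1\<close> and negative at \<open>w2\<close>.\<close>

lemma solution_zigzag:
  assumes sol: "plaplace_solution p V w" and en: "has_energy p V w E" and ran: "range w = {w1..w2}"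
  shows "zigzag (\<tau> w1) (\<tau> w2) (\<lambda>t. \<tau> (w t)) (plaplace_flux p w)"
proof
  have w_deriv: "(w has_real_derivative deriv w t) (at t)" for t
    using sol by (simp add: plaplace_solution_def DERIV_deriv_iff_field_differentiable)
  have f_deriv: "(plaplace_flux p w has_real_derivative - deriv V (w t)) (at t)" for t
  proof -
    have "plaplace_flux p w field_differentiable at t" "deriv (plaplace_flux p w) t = - deriv V (w t)"
      using sol by (auto simp: plaplace_solution_def eq_neg_iff_add_eq_0)
    then show ?thesis using DERIV_deriv_iff_field_differentiable by metis
  qed
  have w_mem: "w t \<in> {w1..w2}" for t using ran by blast
  have abs_w: "\<bar>deriv w t\<bar> = speed (w t)" for t
  proof -
    have "\<bar>deriv w t\<bar> powr p = conj_exp p * (E - V (w t))"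
      using en conj_exp_pos[OF p] unfolding has_energy_def by (simp add: field_simps)
    then have "speed (w t) = (\<bar>deriv w t\<bar> powr p) powr (1 / p)"
      by (simp add: speed_def)
    also have "\<dots> = \<bar>deriv w t\<bar>" using p by (simp add: powr_powr)
    finally show ?thesis ..
  qed
  have w_cont: "continuous_on UNIV w"
    using DERIV_isCont[OF w_deriv] by (simp add: continuous_at_imp_continuous_on)
  fix t
  \<comment> \<open>By conservation of energy the velocity vanishes exactly at the two end
    positions.\<close>
  have inner: "w1 < w t \<and> w t < w2 \<longleftrightarrow> deriv w t \<noteq> 0"
  proof (cases "w t = w1 \<or> w t = w2")
    case True
    then have "speed (w t) = 0" by (elim disjE) simp_all
    with True show ?thesis using abs_w[of t] by auto
  next
    case False
    then show ?thesis using abs_w[of t] w_mem[of t] speed_pos[of "w t"] by auto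
  qed
  have mem: "\<tau> (w t) \<in> {\<tau> w1..\<tau> w2}"
    using \<tau>_image w_mem by blast
  then show "\<tau> w1 \<le> \<tau> (w t)" "\<tau> (w t) \<le> \<tau> w2" by auto
  show "\<tau> w1 < \<tau> w2" using \<tau>_strict_mono w12 by simp
  have "continuous_on UNIV (\<lambda>t. \<tau> (w t))"
    using w_mem by (intro continuous_on_compose2[OF \<tau>_cont w_cont]) auto
  then show "isCont (\<lambda>t. \<tau> (w t)) t"
    by (simp add: continuous_on_eq_continuous_at)
  show "isCont (plaplace_flux p w) t"
    using f_deriv by (rule DERIV_isCont)
  have ends: "\<tau> (w t) = \<tau> w1 \<longleftrightarrow> w t = w1" "\<tau> (w t) = \<tau> w2 \<longleftrightarrow> w t = w2"
    using inj_on_eq_iff[OF \<tau>_inj w_mem] w12 by auto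
  have "plaplace_flux p w t = 0 \<longleftrightarrow> deriv w t = 0"
    using flux_sgn[of w t] by (metis sgn_zero_iff)
  then show "plaplace_flux p w t = 0 \<longleftrightarrow> \<tau> (w t) = \<tau> w1 \<or> \<tau> (w t) = \<tau> w2"
    unfolding ends using inner w_mem[of t] by auto
  have chain: "((\<lambda>t. \<tau> (w t)) has_real_derivative deriv w t / \<bar>deriv w t\<bar>) (at t)"
    if "deriv w t \<noteq> 0"
    using DERIV_chain2[OF \<tau>_deriv w_deriv, of t] inner that 
    unfolding abs_w speed_def by simp
  show "((\<lambda>t. \<tau> (w t)) has_real_derivative 1) (at t)" if "plaplace_flux p w t > 0"
  proof -
    have "deriv w t > 0" using flux_sgn[of w t] that by (metis sgn_greater)
    then show ?thesis using chain by simp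
  qed
  show "((\<lambda>t. \<tau> (w t)) has_real_derivative -1) (at t)" if "plaplace_flux p w t < 0"
  proof -
    have "deriv w t < 0" using flux_sgn[of w t] that by (metis sgn_less)
    then show ?thesis using chain by simp
  qed
  show "\<exists>D>0. (plaplace_flux p w has_real_derivative D) (at t)" if "\<tau> (w t) = \<tau> w1"
    using f_deriv[of t] dV_ends(1) that ends by (intro exI[of _ "- deriv V (w t)"]) auto
  show "\<exists>D<0. (plaplace_flux p w has_real_derivative D) (at t)" if "\<tau> (w t) = \<tau> w2"
    using f_deriv[of t] dV_ends(2) that ends by (intro exI[of _ "- deriv V (w t)"]) auto
qed

text \<open>Injectivity of \<tau> gives \<open>w\<close> and its travel time the same
  periods.\<close>

lemma solution_minimal_period:
  assumes "plaplace_solution p V w" "has_energy p V w E" and ran: "range w = {w1..w2}"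
  shows "is_minimal_period w (2 * L)"
proof -
  interpret zigzag "\<tau> w1" "\<tau> w2" "\<lambda>t. \<tau> (w t)" "plaplace_flux p w"
    by (rule solution_zigzag[OF assms])
  have w_mem: "w t \<in> {w1..w2}" for t using ran by blast
  obtain t0 where "w t0 = w1" using ran w12 
    by (metis atLeastAtMost_iff dual_order.refl less_imp_le rangeE)
  moreover have "periodic_fun_simple (\<lambda>t. \<tau> (w t)) S \<longleftrightarrow> periodic_fun_simple w S" for S
    using inj_on_eq_iff[OF \<tau>_inj w_mem w_mem] by (simp add: periodic_fun_simple_def)
  ultimately show ?thesis
    using minimal_period[of t0] by (simp add: is_minimal_period_def L_def)
qed


section \<open>Construction of a periodic solution\<close>

text \<open>Composing \<open>arccos\<close> with \<open>cos\<close> gives the standard triangle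
  wave; the scaling produces slopes 1 and -1, period \<open>2 * L\<close> and a minimum at time
  0.\<close>

definition triangle :: "real \<Rightarrow> real" where
  "triangle t = \<tau> w1 + L / pi * arccos (cos (pi / L * t))"

definition \<sigma> :: "real \<Rightarrow> real" where
  "\<sigma> = the_inv_into {w1..w2} \<tau>"

definition orbit :: "real \<Rightarrow> real" where
  "orbit t = \<sigma> (triangle t)"

text \<open>The slope of the triangle wave, set to 0 at its corners, the multiples of
  \<open>L\<close>.\<close>

definition dir :: "real \<Rightarrow> real" where
  "dir t = sgn (sin (pi / L * t))"

lemma \<sigma>_\<tau> [simp]: "x \<in> {w1..w2} \<Longrightarrow> \<sigma> (\<tau> x) = x"
  unfolding \<sigma>_def by (rule the_inv_into_f_f[OF \<tau>_inj])

lemma \<tau>_\<sigma> [simp]: "y \<in> {\<tau> w1..\<tau> w2} \<Longrightarrow> \<tau> (\<sigma> y) = y"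
  unfolding \<sigma>_def by (rule f_the_inv_into_f[OF \<tau>_inj]) (simp add: \<tau>_image)

lemma \<sigma>_mem: "y \<in> {\<tau> w1..\<tau> w2} \<Longrightarrow> \<sigma> y \<in> {w1..w2}"
  unfolding \<sigma>_def by (rule the_inv_into_into[OF \<tau>_inj _ subset_refl]) (simp add: \<tau>_image)

lemma \<sigma>_cont: "continuous_on {\<tau> w1..\<tau> w2} \<sigma>"
  unfolding \<tau>_image[symmetric] by (rule continuous_on_inv[OF \<tau>_cont]) auto

text \<open>The inverse function theorem: \<sigma> gives the position as a function of travel time
  and hence moves with velocity \<open>speed\<close>.\<close>

lemma \<sigma>_deriv:
  assumes y: "\<tau> w1 < y" "y < \<tau> w2"
  shows "(\<sigma> has_real_derivative speed (\<sigma> y)) (at y)"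
proof -
  have m: "\<sigma> y \<in> {w1..w2}" "\<tau> (\<sigma> y) = y" using \<sigma>_mem y by auto
  then have inner: "w1 < \<sigma> y" "\<sigma> y < w2" using y by (cases "\<sigma> y = w1"; cases "\<sigma> y = w2"; auto)+
  have "(\<sigma> has_real_derivative inverse (1 / speed (\<sigma> y))) (at y)"
  proof (rule DERIV_inverse_function[where f = \<tau>, OF _ _ y])
    show "(\<tau> has_real_derivative 1 / speed (\<sigma> y)) (at (\<sigma> y))"
      using \<tau>_deriv[OF inner] by (simp add: speed_def)
    show "1 / speed (\<sigma> y) \<noteq> 0" using speed_pos[OF inner] by simp
    show "\<tau> (\<sigma> u) = u" if "\<tau> w1 < u" "u < \<tau> w2" for u using that by simp
    show "isCont \<sigma> y"
      using continuous_on_interior[OF \<sigma>_cont] y by simp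
  qed
  then show ?thesis by simp
qed

lemma triangle_mem: "triangle t \<in> {\<tau> w1..\<tau> w2}"
proof -
  have "0 \<le> arccos (cos (pi / L * t))" "arccos (cos (pi / L * t)) \<le> pi"
    by (auto intro: arccos_lbound arccos_ubound)
  then have "0 \<le> L / pi * arccos (cos (pi / L * t))"
    and "L / pi * arccos (cos (pi / L * t)) \<le> L / pi * pi"
    using L_pos by (intro mult_nonneg_nonneg mult_left_mono; simp)+
  then show ?thesis by (simp add: triangle_def L_def)
qed

lemma triangle_cont: "continuous_on S triangle"
  unfolding triangle_def by (intro continuous_intros) auto

lemma dir_cases: "dir t = 0 \<or> dir t = 1 \<or> dir t = -1"
  by (auto simp: dir_def sgn_if)

lemma triangle_turn:
  assumes "dir t = 0"
  shows "triangle t = \<tau> w1 \<or> triangle t = \<tau> w2"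
proof -
  have "sin (pi / L * t) = 0" using assms by (simp add: dir_def sgn_zero_iff)
  then have "cos (pi / L * t) = 1 \<or> cos (pi / L * t) = -1"
    using sin_zero_abs_cos_one by force
  then show ?thesis using L_pos by (auto simp: triangle_def L_def arccos_minus_1)
qed

lemma sin_sqrt: "sqrt (1 - (cos x)\<^sup>2) = \<bar>sin x :: real\<bar>"
  by (simp flip: sin_squared_eq)

lemma triangle_deriv:
  assumes "dir t \<noteq> 0"
  shows "(triangle has_real_derivative dir t) (at t)" "\<tau> w1 < triangle t" "triangle t < \<tau> w2"
proof -
  define x where "x = pi / L * t"
  have s: "sin x \<noteq> 0" using assms by (simp add: dir_def sgn_zero_iff x_def)
  then have "\<bar>cos x\<bar> < 1"
    using sin_squared_eq[of x] zero_less_power2[of "sin x"] abs_square_less_1[of "cos x"] by simp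
  then have c: "-1 < cos x" "cos x < 1" by auto
  have "((\<lambda>t. arccos (cos (pi / L * t))) has_real_derivative
      inverse (- sqrt (1 - (cos x)\<^sup>2)) * (- sin x * (pi / L))) (at t)"
  proof (rule DERIV_chain2[of arccos])
    show "(arccos has_real_derivative inverse (- sqrt (1 - (cos x)\<^sup>2))) (at (cos (pi / L * t)))"
      using DERIV_arccos[OF c] by (simp add: x_def)
    show "((\<lambda>t. cos (pi / L * t)) has_real_derivative - sin x * (pi / L)) (at t)"
      unfolding x_def by (rule derivative_eq_intros refl | simp)+
  qed
  from DERIV_add[OF DERIV_const DERIV_cmult[OF this, of "L / pi"], of "\<tau> w1"]
  have "(triangle has_real_derivative
      0 + L / pi * (inverse (- sqrt (1 - (cos x)\<^sup>2)) * (- sin x * (pi / L)))) (at t)"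
    unfolding triangle_def[abs_def] .
  moreover have "0 + L / pi * (inverse (- sqrt (1 - (cos x)\<^sup>2)) * (- sin x * (pi / L))) = dir t"
    using s L_pos unfolding sin_sqrt dir_def x_def[symmetric]
    by (cases "sin x > 0") (simp_all add: field_simps)
  ultimately show "(triangle has_real_derivative dir t) (at t)" by (simp only:)
  have "0 < arccos (cos x)" "arccos (cos x) < pi"
    using arccos_lt_bounded[OF c] by auto
  then have "0 < L / pi * arccos (cos x)" "L / pi * arccos (cos x) < L / pi * pi"
    using L_pos by (intro mult_pos_pos mult_strict_left_mono; simp)+
  then show "\<tau> w1 < triangle t" "triangle t < \<tau> w2"
    by (simp_all add: triangle_def L_def x_def)
qed

text \<open>Turning times are isolated, because zeros of the sine are simple; this opens the way to
  the limit argument for derivatives there.\<close>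

lemma dir_eventually_nonzero: "eventually (\<lambda>x. dir x \<noteq> 0) (at t)"
proof (cases "dir t = 0")
  case False
  then have s: "sin (pi / L * t) \<noteq> 0" by (simp add: dir_def sgn_zero_iff)
  have "((\<lambda>x. sin (pi / L * x)) \<longlongrightarrow> sin (pi / L * t)) (at t)"
    by (intro tendsto_intros)
  then have "\<forall>\<^sub>F x in at t. sin (pi / L * x) \<noteq> 0"
    using s by (rule tendsto_imp_eventually_ne)
  then show ?thesis
    by (rule eventually_mono) (simp add: dir_def sgn_zero_iff)
next
  case True
  define k where "k = pi / L"
  have "k \<noteq> 0" using L_pos by (simp add: k_def)
  have s: "sin (k * t) = 0" using True by (simp add: dir_def sgn_zero_iff k_def)
  then have "cos (k * t) * k \<noteq> 0"
    using sin_zero_abs_cos_one[OF s] \<open>k \<noteq> 0\<close> by auto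
  moreover have "((\<lambda>x. sin (k * x)) has_real_derivative cos (k * t) * k) (at t)"
    by (auto intro!: derivative_eq_intros)
  then have "((\<lambda>x. (sin (k * x) - sin (k * t)) / (x - t)) \<longlongrightarrow> cos (k * t) * k) (at t)"
    by (simp add: has_field_derivative_iff)
  ultimately have "eventually (\<lambda>x. (sin (k * x) - sin (k * t)) / (x - t) \<noteq> 0) (at t)"
    by (rule tendsto_imp_eventually_ne[rotated])
  then show ?thesis
    by (rule eventually_mono) (auto simp: s dir_def k_def[symmetric] sgn_zero_iff)
qed

lemma orbit_mem: "orbit t \<in> {w1..w2}"
  unfolding orbit_def by (rule \<sigma>_mem[OF triangle_mem])

lemma orbit_cont: "continuous_on UNIV orbit"
  unfolding orbit_def
  by (rule continuous_on_compose2[OF \<sigma>_cont triangle_cont]) (use triangle_mem in auto)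

lemma orbit_turn:
  assumes "dir t = 0"
  shows "speed (orbit t) = 0"
  using triangle_turn[OF assms] w12 by (auto simp: orbit_def)

lemma orbit_speed_cont: "continuous_on UNIV (\<lambda>t. speed (orbit t))"
  by (rule continuous_on_compose2[OF speed_cont orbit_cont]) (use orbit_mem in auto)

lemma dir_abs_le: "\<bar>dir t * r\<bar> \<le> \<bar>r\<bar>"
  using dir_cases[of t] by auto

text \<open>The jump of \<open>dir\<close> at a corner is harmless when its bounded values multiply
  a continuous function vanishing there.\<close>

lemma dir_mult_tendsto:
  assumes "continuous_on UNIV g" "g t = 0"
  shows "((\<lambda>x. dir x * g x) \<longlongrightarrow> 0) (at t)"
proof (rule Lim_null_comparison[of _ "\<lambda>x. \<bar>g x\<bar>"])
  show "((\<lambda>x. \<bar>g x\<bar>) \<longlongrightarrow> 0) (at t)"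
    using assms by (metis continuous_on_def UNIV_I tendsto_rabs_zero_iff)
qed (use dir_abs_le in auto)

text \<open>The chain rule applies between turning times; at a turning time the speed tends to zero,
  and the derivative is recovered as a limit.\<close>

lemma orbit_deriv: "(orbit has_real_derivative dir t * speed (orbit t)) (at t)"
proof -
  have inner: "(orbit has_real_derivative dir x * speed (orbit x)) (at x)" if "dir x \<noteq> 0" for x
    using DERIV_chain2[OF \<sigma>_deriv triangle_deriv(1), OF triangle_deriv(2,3) that, OF that that]
    unfolding orbit_def[abs_def] by (simp add: mult.commute)
  show ?thesis
  proof (cases "dir t = 0")
    case True
    show ?thesis
    proof (rule DERIV_limit_at_point)
      show "isCont orbit t" using orbit_cont by (simp add: continuous_on_eq_continuous_at)
      show "\<forall>\<^sub>F x in at t. (orbit has_real_derivative dir x * speed (orbit x)) (at x)"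
        using dir_eventually_nonzero by eventually_elim (rule inner)
      show "((\<lambda>x. dir x * speed (orbit x)) \<longlongrightarrow> dir t * speed (orbit t)) (at t)"
        using dir_mult_tendsto[OF orbit_speed_cont orbit_turn[OF True]] orbit_turn[OF True] by simp
    qed
  qed (rule inner)
qed

lemma deriv_orbit: "deriv orbit t = dir t * speed (orbit t)"
  by (rule DERIV_imp_deriv[OF orbit_deriv])

lemma orbit_range: "range orbit = {w1..w2}"
proof
  show "range orbit \<subseteq> {w1..w2}" using orbit_mem by auto
  show "{w1..w2} \<subseteq> range orbit"
  proof
    fix x assume x: "x \<in> {w1..w2}"
    then have "\<tau> x \<in> {\<tau> w1..\<tau> w2}" using \<tau>_image by blast
    then have "0 \<le> pi / L * (\<tau> x - \<tau> w1)" "pi / L * (\<tau> x - \<tau> w1) \<le> pi"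
      using L_pos by (auto simp: L_def field_simps)
    \<comment> \<open>During the first ascent, which starts at time 0, the wave reaches the level
      \<tau>(x) after exactly this time.\<close>
    then have "triangle (\<tau> x - \<tau> w1) = \<tau> x"
      using L_pos by (simp add: triangle_def arccos_cos)
    then have "orbit (\<tau> x - \<tau> w1) = x" using x by (simp add: orbit_def)
    then show "x \<in> range orbit" using rangeI[of orbit "\<tau> x - \<tau> w1"] by simp
  qed
qed

lemma orbit_energy: "has_energy p V orbit E"
  unfolding has_energy_def
proof
  fix t
  have "\<bar>deriv orbit t\<bar> = speed (orbit t)"
    using dir_cases[of t] orbit_turn[of t] by (auto simp: deriv_orbit speed_def)
  then have "\<bar>deriv orbit t\<bar> powr p = conj_exp p * (E - V (orbit t))"
    using p V_le[OF orbit_mem, of t] conj_exp_pos[OF p] by (simp add: speed_def powr_powr)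
  then show "1 / conj_exp p * \<bar>deriv orbit t\<bar> powr p + V (orbit t) = E"
    using conj_exp_pos[OF p] by simp
qed

text \<open>The absolute value |w'|^(p-1) of the flux along the orbit, expressed through the
  energy.\<close>

definition momentum :: "real \<Rightarrow> real" where
  "momentum t = (conj_exp p * (E - V (orbit t))) powr (1 - 1 / p)"

lemma orbit_flux: "plaplace_flux p orbit t = dir t * momentum t"
proof (cases "dir t = 0 \<or> speed (orbit t) = 0")
  case True
  then have "speed (orbit t) = 0" using orbit_turn by auto
  moreover from this have z: "conj_exp p * (E - V (orbit t)) = 0" by (simp add: speed_def)
  have "momentum t = 0" unfolding momentum_def z by simp
  ultimately show ?thesis by (simp add: plaplace_flux_def deriv_orbit)
next
  case False
  then have pos: "conj_exp p * (E - V (orbit t)) > 0"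
    using V_le[OF orbit_mem, of t] conj_exp_pos[OF p] by (auto simp: speed_def)
  have "\<bar>dir t * speed (orbit t)\<bar> = speed (orbit t)"
    using dir_cases[of t] False by (auto simp: speed_def)
  then have "plaplace_flux p orbit t = dir t * (speed (orbit t) powr (p - 2) * speed (orbit t) powr 1)"
    by (simp add: plaplace_flux_def deriv_orbit speed_def)
  also have "\<dots> = dir t * momentum t"
    using p by (simp only: speed_def momentum_def powr_powr powr_add[symmetric]) (simp add: field_simps)
  finally show ?thesis .
qed

lemma momentum_cont: "continuous_on UNIV momentum"
  unfolding momentum_def using V_le[OF orbit_mem] p conj_exp_pos[OF p]
  by (intro continuous_on_powr' continuous_intros continuous_on_compose2[OF V_cont[of UNIV] orbit_cont]) auto

lemma momentum_turn: "dir t = 0 \<Longrightarrow> momentum t = 0"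
  using orbit_turn[of t] by (auto simp: speed_def momentum_def)

text \<open>Between turning times (1 - 1/p) \<open>conj_exp p\<close> = 1, and the remaining power
  of the kinetic term cancels \<open>speed\<close>, which leaves -V' times the square of
  \<open>dir\<close>. At turning times \<open>momentum\<close> vanishes and continuity of V'
  supplies the limit.\<close>

lemma orbit_flux_deriv: "(plaplace_flux p orbit has_real_derivative - deriv V (orbit t)) (at t)"
proof -
  let ?f = "\<lambda>t. dir t * momentum t"
  have inner: "(?f has_real_derivative - deriv V (orbit x)) (at x)" if d: "dir x \<noteq> 0" for x
  proof -
    define c where "c = conj_exp p * (E - V (orbit x))"
    have "triangle x \<in> {\<tau> w1..\<tau> w2}" "\<tau> (orbit x) = triangle x"
      using triangle_mem by (simp_all add: orbit_def)
    with triangle_deriv(2,3)[OF d] have "orbit x \<noteq> w1" "orbit x \<noteq> w2" by auto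
    then have "V (orbit x) < E" using V_less[of "orbit x"] orbit_mem[of x] by auto
    then have c: "c > 0" using conj_exp_pos[OF p] by (simp add: c_def)
    have "(momentum has_real_derivative (1 - 1 / p) * c powr (1 - 1 / p - 1) *
        (conj_exp p * (0 - deriv V (orbit x) * (dir x * speed (orbit x))))) (at x)"
      unfolding momentum_def[abs_def] c_def
      by (rule DERIV_chain2[OF has_real_derivative_powr])
        (use c in \<open>auto simp: c_def intro!: derivative_eq_intros DERIV_chain2[OF V_deriv] orbit_deriv\<close>)
    moreover have "(1 - 1 / p) * conj_exp p = 1" using p by (simp add: conj_exp_def field_simps)
    moreover have "c powr (1 - 1 / p - 1) * speed (orbit x) = 1"
      using c unfolding speed_def c_def[symmetric] by (simp flip: powr_add)
    ultimately have "(momentum has_real_derivative - deriv V (orbit x) * dir x) (at x)"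
      by (smt (verit) mult.assoc mult.commute mult_cancel_right1 mult_minus_left)
    from DERIV_cmult[OF this, of "dir x"]
    have "((\<lambda>t. dir x * momentum t) has_real_derivative - deriv V (orbit x)) (at x)"
      using dir_cases[of x] d by auto
    \<comment> \<open>On this neighbourhood the sine keeps its sign, so the constant
      \<open>dir x\<close> can be replaced by \<open>dir u\<close>.\<close>
    moreover have "open {u. 0 < dir x * sin (pi / L * u)}"
      by (intro open_Collect_less continuous_intros)
    moreover have "x \<in> {u. 0 < dir x * sin (pi / L * u)}"
      using d by (auto simp: dir_def sgn_if)
    moreover have "dir x * momentum u = dir u * momentum u" if "u \<in> {u. 0 < dir x * sin (pi / L * u)}" for u
      using that dir_cases[of x] by (auto simp: dir_def[of u])
    ultimately show ?thesis
      by (rule has_field_derivative_transform_within_open)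
  qed
  have "(?f has_real_derivative - deriv V (orbit t)) (at t)"
  proof (cases "dir t = 0")
    case True
    show ?thesis
    proof (rule DERIV_limit_at_point)
      show "isCont ?f t"
        using dir_mult_tendsto[OF momentum_cont momentum_turn[OF True]] True by (simp add: isCont_def)
      show "\<forall>\<^sub>F x in at t. (?f has_real_derivative - deriv V (orbit x)) (at x)"
        using dir_eventually_nonzero by eventually_elim (rule inner)
      have "isCont orbit t" using orbit_cont by (simp add: continuous_on_eq_continuous_at)
      then show "((\<lambda>x. - deriv V (orbit x)) \<longlongrightarrow> - deriv V (orbit t)) (at t)"
        using isCont_o2[OF _ dV_cont] by (intro tendsto_minus) (simp add: isCont_def)
    qed
  qed (rule inner)
  then show ?thesis by (simp add: orbit_flux[abs_def])
qed

lemma orbit_solution: "plaplace_solution p V orbit"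
  unfolding plaplace_solution_def
  using orbit_deriv orbit_flux_deriv DERIV_imp_deriv[OF orbit_flux_deriv]
  by (auto simp: field_differentiable_def)

end

section \<open>The potential well\<close>

text \<open>Add the tangent-line inequalities at the two points.\<close>

lemma convex_on_deriv_le:
  fixes f :: "real \<Rightarrow> real"
  assumes "convex_on S f" "open S" "x \<in> S" "y \<in> S" "x \<le> y" "connected S"
    and dx: "(f has_real_derivative a) (at x)" and dy: "(f has_real_derivative b) (at y)"
  shows "a \<le> b"
proof (cases "x = y")
  case True
  then show ?thesis using DERIV_unique[OF dx] dy by auto
next
  case False
  have "a * (y - x) \<le> f y - f x" "b * (x - y) \<le> f x - f y"
    using assms by (auto intro!: convex_on_imp_above_tangent[of S] simp: interior_open has_field_derivative_at_within)
  then have "a * (y - x) \<le> b * (y - x)" by (simp add: algebra_simps)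
  then show ?thesis using False assms(5) by simp
qed

locale potential_well =
  fixes V :: "real \<Rightarrow> real" and A B Estar :: real
  assumes V_deriv: "(V has_real_derivative deriv V x) (at x)"
    and dV_deriv: "(deriv V has_real_derivative deriv (deriv V) x) (at x)"
    and AB: "0 < A" "A < B" and Estar: "0 < Estar" "V 0 = Estar" "V B = Estar"
    and VA: "V A = 0" "deriv V A = 0" "deriv (deriv V) A > 0"
    and V_bounds: "x \<in> {0<..<A} \<union> {A<..<B} \<Longrightarrow> 0 < V x \<and> V x < Estar"
    and dV_nonzero: "x \<in> {0<..<A} \<union> {A<..<B} \<Longrightarrow> deriv V x \<noteq> 0"
    and convex: "convex_on {0<..<B}
      (\<lambda>w. if w = A then 1 / (2 * deriv (deriv V) A) else V w / (deriv V w)\<^sup>2)"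
begin

section \<open>Sign of V' and regularity of G\<close>

definition G :: "real \<Rightarrow> real" where
  "G w = (if w = A then 1 / (2 * deriv (deriv V) A) else V w / (deriv V w)\<^sup>2)"

definition h :: "real \<Rightarrow> real" where
  "h x = sgn (x - A) * sqrt (V x)"

lemma V_cont: "isCont V x" and dV_cont: "isCont (deriv V) x"
  using V_deriv dV_deriv by (auto intro: DERIV_isCont)

lemma off_A: "x \<in> {0<..<B} \<Longrightarrow> x \<noteq> A \<Longrightarrow> 0 < V x \<and> deriv V x \<noteq> 0"
  using V_bounds[of x] dV_nonzero[of x] by (cases x A rule: linorder_cases) auto

lemma V_nonneg: "x \<in> {0..B} \<Longrightarrow> 0 \<le> V x"
  using off_A[of x] Estar VA by (cases "x = 0 \<or> x = A \<or> x = B") auto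

lemma dV_zero_between:
  assumes "u < v" "deriv V u * deriv V v < 0"
  shows "\<exists>z. u < z \<and> z < v \<and> deriv V z = 0"
proof -
  have c: "continuous_on {u..v} (deriv V)"
    using dV_cont by (simp add: continuous_at_imp_continuous_on)
  have "\<exists>z\<ge>u. z \<le> v \<and> deriv V z = 0"
    using assms IVT'[OF _ _ _ c, of 0] IVT2'[OF _ _ _ c, of 0] by (auto simp: mult_less_0_iff)
  then obtain z where z: "u \<le> z" "z \<le> v" "deriv V z = 0" by auto
  then have "z \<noteq> u" "z \<noteq> v" using assms(2) by auto
  with z show ?thesis by force
qed

text \<open>\<open>V\<close> drops below \<open>V 0\<close> on the way to \<open>x\<close>, so V' is
  negative somewhere before \<open>x\<close>; a positive value at \<open>x\<close> would force a
  forbidden zero in between.\<close>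

lemma dV_neg:
  assumes x: "0 < x" "x < A"
  shows "deriv V x < 0"
proof (rule ccontr)
  assume "\<not> deriv V x < 0"
  then have pos: "deriv V x > 0" using dV_nonzero[of x] x by auto
  obtain z where z: "0 < z" "z < x" "V x - V 0 = (x - 0) * deriv V z"
    using MVT2[of 0 x V "deriv V"] V_deriv x by blast
  then have "x * deriv V z < 0" using V_bounds[of x] x Estar by auto
  then have "deriv V z < 0" using x by (simp add: mult_less_0_iff)
  with pos obtain u where "z < u" "u < x" "deriv V u = 0"
    using dV_zero_between[of z x] z by (auto simp: mult_neg_pos)
  then show False using dV_nonzero[of u] z x by auto
qed

lemma dV_pos:
  assumes x: "A < x" "x < B"
  shows "deriv V x > 0"
proof (rule ccontr)
  assume "\<not> deriv V x > 0"
  then have neg: "deriv V x < 0" using dV_nonzero[of x] x by auto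
  obtain z where z: "A < z" "z < x" "V x - V A = (x - A) * deriv V z"
    using MVT2[of A x V "deriv V"] V_deriv x by blast
  then have "(x - A) * deriv V z > 0" using V_bounds[of x] x VA by auto
  then have "deriv V z > 0" using x by (simp add: zero_less_mult_iff)
  with neg obtain u where "z < u" "u < x" "deriv V u = 0"
    using dV_zero_between[of z x] z by (auto simp: mult_pos_neg)
  then show False using dV_nonzero[of u] z x by auto
qed

lemma G_pos: "x \<in> {0<..<B} \<Longrightarrow> 0 < G x"
  using off_A[of x] VA by (cases "x = A") (auto simp: G_def)

lemma convex_G: "convex_on {0<..<B} G"
  using convex by (simp add: G_def[abs_def])

text \<open>Convexity on an open interval implies continuity, which covers the point
  \<open>A\<close> without any expansion of \<open>V\<close>.\<close>

lemma G_cont: "continuous_on {0<..<B} G"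
  by (rule convex_on_continuous[OF _ convex_G]) simp

lemma G_differentiable:
  assumes "x \<in> {0<..<B}" "x \<noteq> A"
  shows "\<exists>D. (G has_real_derivative D) (at x)"
proof -
  have "deriv V x \<noteq> 0" using off_A[of x] assms by auto
  then have "((\<lambda>w. V w / (deriv V w)\<^sup>2) has_real_derivative
      (deriv V x * (deriv V x)\<^sup>2 - V x * (2 * deriv V x * deriv (deriv V) x)) / ((deriv V x)\<^sup>2 * (deriv V x)\<^sup>2)) (at x)"
    using V_deriv[of x] dV_deriv[of x] by (auto intro!: derivative_eq_intros)
  moreover have "open (- {A})" "x \<in> - {A}" using assms by auto
  ultimately have "(G has_real_derivative
      (deriv V x * (deriv V x)\<^sup>2 - V x * (2 * deriv V x * deriv (deriv V) x)) / ((deriv V x)\<^sup>2 * (deriv V x)\<^sup>2)) (at x)"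
    by (rule has_field_derivative_transform_within_open) (auto simp: G_def)
  then show ?thesis by blast
qed

section \<open>The signed square root of V as a coordinate on the well\<close>

lemma h_square: "x \<in> {0..B} \<Longrightarrow> (h x)\<^sup>2 = V x"
  using V_nonneg[of x] VA by (cases "x = A") (auto simp: h_def power_mult_distrib sgn_if)

lemma h_cont: "isCont h x"
proof (cases "x = A")
  case False
  then show ?thesis
    unfolding h_def isCont_def using V_cont[of x]
    by (intro tendsto_intros) (auto simp: isCont_def)
next
  case True
  \<comment> \<open>The sign factor jumps at \<open>A\<close>, so \<open>h\<close> is squeezed by
    this continuous majorant of |h|, which vanishes there.\<close>
  have "((\<lambda>x. sqrt \<bar>V x\<bar>) \<longlongrightarrow> sqrt \<bar>V A\<bar>) (at A)"
    using V_cont[of A] by (intro tendsto_intros) (simp add: isCont_def)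
  then have "(h \<longlongrightarrow> 0) (at A)"
    by (intro Lim_null_comparison[of h "\<lambda>x. sqrt \<bar>V x\<bar>"] always_eventually)
      (auto simp: h_def VA abs_mult sgn_if simp flip: real_sqrt_abs')
  then show ?thesis using True by (simp add: isCont_def h_def)
qed

text \<open>Away from \<open>A\<close> the sign of V' is that of x - A, so the chain rule gives |V'|
  / (2 sqrt V). At \<open>A\<close> the formula follows by passing to the limit with the continuous
  \<open>G\<close>.\<close>

lemma h_deriv:
  assumes x: "x \<in> {0<..<B}"
  shows "(h has_real_derivative 1 / (2 * sqrt (G x))) (at x)"
proof -
  have off: "(h has_real_derivative 1 / (2 * sqrt (G x))) (at x)" if x: "x \<in> {0<..<B}" "x \<noteq> A" for x
  proof -
    have V: "V x > 0" using off_A[of x] x by auto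
    have s: "sgn (deriv V x) = sgn (x - A)" "deriv V x \<noteq> 0"
      using dV_pos[of x] dV_neg[of x] x by (cases "x < A"; auto)+
    have "((\<lambda>u. sgn (x - A) * sqrt (V u)) has_real_derivative sgn (x - A) * (deriv V x * (inverse (sqrt (V x)) / 2))) (at x)"
      using DERIV_cmult[OF DERIV_chain2[OF DERIV_real_sqrt[OF V] V_deriv], of "sgn (x - A)"]
      by (simp add: mult_ac)
    moreover have "open {u. 0 < (x - A) * (u - A)}"
      by (intro open_Collect_less continuous_intros)
    moreover have "x \<in> {u. 0 < (x - A) * (u - A)}" using x by (auto simp: zero_less_mult_iff)
    ultimately have "(h has_real_derivative sgn (x - A) * (deriv V x * (inverse (sqrt (V x)) / 2))) (at x)"
      by (rule has_field_derivative_transform_within_open) (auto simp: h_def zero_less_mult_iff)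
    moreover have "sgn (x - A) * (deriv V x * (inverse (sqrt (V x)) / 2)) = 1 / (2 * sqrt (G x))"
      unfolding s(1)[symmetric] using s(2) x(2) V
      by (simp add: G_def real_sqrt_divide abs_sgn field_simps)
    ultimately show ?thesis by (simp only:)
  qed
  show ?thesis
  proof (cases "x = A")
    case True
    show ?thesis
    proof (rule DERIV_limit_at_point[OF h_cont])
      have "\<forall>\<^sub>F u in at x. u \<in> {0<..<B} \<and> u \<noteq> A"
        using eventually_at_in_open[of "{0<..<B}" x] x True by auto
      then show "\<forall>\<^sub>F u in at x. (h has_real_derivative 1 / (2 * sqrt (G u))) (at u)"
        by eventually_elim (use off in auto)
      have "(G \<longlongrightarrow> G x) (at x)"
        using G_cont x by (auto simp: continuous_on_eq_continuous_at isCont_def)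
      then show "((\<lambda>u. 1 / (2 * sqrt (G u))) \<longlongrightarrow> 1 / (2 * sqrt (G x))) (at x)"
        using G_pos[OF x] by (intro tendsto_intros) auto
    qed
  qed (use off x in auto)
qed

lemma h_strict_mono:
  assumes "0 \<le> x" "x < z" "z \<le> B"
  shows "h x < h z"
proof (rule DERIV_pos_imp_increasing_open[OF assms(2)])
  show "\<exists>y. (h has_real_derivative y) (at u) \<and> 0 < y" if "x < u" "u < z" for u
    using h_deriv[of u] G_pos[of u] that assms by (intro exI[of _ "1 / (2 * sqrt (G u))"]) auto
  show "continuous_on {x..z} h"
    using h_cont by (simp add: continuous_at_imp_continuous_on)
qed

section \<open>The inverse coordinate\<close>

definition r :: real where "r = sqrt Estar"

definition \<xi> :: "real \<Rightarrow> real" where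
  "\<xi> = the_inv_into {0..B} h"

lemma h_ends [simp]: "h 0 = - r" "h B = r" "h A = 0"
  using AB Estar by (simp_all add: h_def r_def)

lemma h_inj: "inj_on h {0..B}"
  by (rule linorder_inj_onI) (use h_strict_mono in \<open>force+\<close>)

lemma h_cont_on: "continuous_on S h"
  using h_cont by (simp add: continuous_at_imp_continuous_on)

lemma h_image: "h ` {0..B} = {-r..r}"
proof
  show "h ` {0..B} \<subseteq> {-r..r}"
  proof
    fix y assume "y \<in> h ` {0..B}"
    then obtain x where "x \<in> {0..B}" "y = h x" by auto
    then show "y \<in> {-r..r}"
      using h_strict_mono[of 0 x] h_strict_mono[of x B] Estar by (cases "x = 0"; cases "x = B") (auto simp: r_def)
  qed
  show "{-r..r} \<subseteq> h ` {0..B}"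
  proof
    fix y assume "y \<in> {-r..r}"
    then obtain x where "0 \<le> x" "x \<le> B" "h x = y"
      using IVT'[of h 0 y B] AB h_cont_on by auto
    then show "y \<in> h ` {0..B}" by force
  qed
qed

lemma \<xi>_h: "x \<in> {0..B} \<Longrightarrow> \<xi> (h x) = x"
  unfolding \<xi>_def by (rule the_inv_into_f_f[OF h_inj])

lemma h_\<xi>: "y \<in> {-r..r} \<Longrightarrow> h (\<xi> y) = y"
  unfolding \<xi>_def by (rule f_the_inv_into_f[OF h_inj]) (simp add: h_image)

lemma \<xi>_mem: "y \<in> {-r<..<r} \<Longrightarrow> \<xi> y \<in> {0<..<B}"
proof -
  assume y: "y \<in> {-r<..<r}"
  then have "\<xi> y \<in> {0..B}"
    unfolding \<xi>_def by (intro the_inv_into_into[OF h_inj _ subset_refl]) (simp add: h_image)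
  moreover have "\<xi> y \<noteq> 0" "\<xi> y \<noteq> B" using h_\<xi>[of y] y h_ends by auto
  ultimately show ?thesis by auto
qed

lemma V_\<xi>: "y \<in> {-r<..<r} \<Longrightarrow> V (\<xi> y) = y\<^sup>2"
  using h_square[of "\<xi> y"] \<xi>_mem[of y] h_\<xi>[of y] by auto

lemma \<xi>_0: "\<xi> 0 = A"
  using \<xi>_h[of A] AB by simp

lemma \<xi>_strict_mono:
  assumes "-r < y" "y < z" "z < r"
  shows "\<xi> y < \<xi> z"
proof (rule ccontr)
  assume "\<not> \<xi> y < \<xi> z"
  then have "h (\<xi> z) \<le> h (\<xi> y)"
    using h_strict_mono[of "\<xi> z" "\<xi> y"] \<xi>_mem[of y] \<xi>_mem[of z] assms
    by (cases "\<xi> y = \<xi> z") auto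
  then show False using h_\<xi> assms by auto
qed

lemma \<xi>_deriv:
  assumes y: "y \<in> {-r<..<r}"
  shows "(\<xi> has_real_derivative 2 * sqrt (G (\<xi> y))) (at y)"
proof -
  have "(\<xi> has_real_derivative inverse (1 / (2 * sqrt (G (\<xi> y))))) (at y)"
  proof (rule DERIV_inverse_function[where f = h and a = "-r" and b = r])
    show "(h has_real_derivative 1 / (2 * sqrt (G (\<xi> y)))) (at (\<xi> y))"
      by (rule h_deriv[OF \<xi>_mem[OF y]])
    show "1 / (2 * sqrt (G (\<xi> y))) \<noteq> 0" using G_pos[OF \<xi>_mem[OF y]] by simp
    show "h (\<xi> u) = u" if "-r < u" "u < r" for u using h_\<xi> that by simp
    have "continuous_on {-r..r} \<xi>"
      unfolding h_image[symmetric]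
      by (rule continuous_on_inv[OF h_cont_on]) (auto simp: \<xi>_h)
    from continuous_on_interior[OF this] show "isCont \<xi> y" using y by simp
  qed (use y in auto)
  then show ?thesis by simp
qed

section \<open>Monotonicity of the even part of q\<close>

definition q :: "real \<Rightarrow> real" where
  "q y = sqrt (G (\<xi> y))"

lemma q_pos: "y \<in> {-r<..<r} \<Longrightarrow> 0 < q y"
  using G_pos[OF \<xi>_mem] by (simp add: q_def)

lemma q_cont: "continuous_on {-r<..<r} q"
  unfolding q_def
proof (intro continuous_intros continuous_on_compose2[OF G_cont])
  show "continuous_on {-r<..<r} \<xi>"
    using DERIV_isCont[OF \<xi>_deriv] by (intro continuous_at_imp_continuous_on) blast
qed (use \<xi>_mem in auto)

text \<open>The factor 2 sqrt G from the derivative of \<xi> cancels the one from the square root,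
  leaving just the slope of \<open>G\<close>.\<close>

lemma q_deriv:
  assumes y: "y \<in> {-r<..<r}" and D: "(G has_real_derivative D) (at (\<xi> y))"
  shows "(q has_real_derivative D) (at y)"
proof -
  have "G (\<xi> y) > 0" by (rule G_pos[OF \<xi>_mem[OF y]])
  from DERIV_chain2[OF DERIV_real_sqrt[OF this] DERIV_chain2[OF D \<xi>_deriv[OF y]]] this
  show ?thesis unfolding q_def[abs_def] by (simp add: field_simps)
qed

text \<open>The derivative of the symmetrised function is the difference of the slopes of the
  convex function \<open>G\<close> at the two points of the level set.\<close>

lemma q_even_part_mono:
  assumes "0 \<le> y" "y \<le> z" "z < r"
  shows "q y + q (- y) \<le> q z + q (- z)"
proof (rule DERIV_nonneg_imp_increasing_open[OF assms(2)])
  fix u assume u: "y < u" "u < z"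
  then have u': "u \<in> {-r<..<r}" "- u \<in> {-r<..<r}" "0 < u" using assms by auto
  have lt: "\<xi> (- u) < A" "A < \<xi> u"
    using \<xi>_strict_mono[of "- u" 0] \<xi>_strict_mono[of 0 u] u' by (auto simp: \<xi>_0)
  obtain a b where a: "(G has_real_derivative a) (at (\<xi> (- u)))"
    and b: "(G has_real_derivative b) (at (\<xi> u))"
    using G_differentiable \<xi>_mem u' lt by (metis less_irrefl)
  have "a \<le> b"
    by (rule convex_on_deriv_le[OF convex_G _ _ _ _ _ a b]) (use \<xi>_mem u' lt in auto)
  moreover have "((\<lambda>u. q u + q (- u)) has_real_derivative b + a * - 1) (at u)"
    by (intro DERIV_add q_deriv u' b DERIV_chain2[where f = q and g = uminus] a)
      (auto intro!: derivative_eq_intros)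
  ultimately show "\<exists>D. ((\<lambda>u. q u + q (- u)) has_real_derivative D) (at u) \<and> 0 \<le> D"
    by force
next
  show "continuous_on {y..z} (\<lambda>u. q u + q (- u))"
    using assms by (intro continuous_intros continuous_on_compose2[OF q_cont]) auto
qed

section \<open>The angular integral\<close>

text \<open>The period integral after h(w) = s sin \<theta>, without its prefactor; it is used with
  \<open>s = sqrt E\<close> and \<open>b = 1 - 2 / p\<close>.\<close>

definition J :: "real \<Rightarrow> real \<Rightarrow> real" where
  "J b s = integral {- (pi / 2)..pi / 2} (\<lambda>\<theta>. q (s * sin \<theta>) * cos \<theta> powr b)"

lemma scaled_sin_mem:
  assumes "0 \<le> s" "s < r"
  shows "s * sin x \<in> {-r<..<r}"
proof -
  have "\<bar>s * sin x\<bar> \<le> s * 1"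
    unfolding abs_mult using assms by (intro mult_mono) auto
  then show ?thesis using assms by (auto simp: abs_le_iff)
qed

lemma cos_half_nonneg: "x \<in> {- (pi / 2)..pi / 2} \<Longrightarrow> cos x \<ge> 0"
  by (auto intro: cos_ge_zero)

text \<open>Positivity of \<open>b\<close> gives continuity up to the end points, where the cosine
  vanishes.\<close>

lemma J_integrand_cont:
  assumes "0 \<le> s" "s < r" "0 < b"
  shows "continuous_on {- (pi / 2)..pi / 2} (\<lambda>\<theta>. q (s * sin \<theta>) * cos \<theta> powr b)"
  using scaled_sin_mem[OF assms(1,2)] cos_half_nonneg assms(3)
  by (intro continuous_intros continuous_on_compose2[OF q_cont] continuous_on_powr') auto

text \<open>Average the integral with its reflection in \<theta>: sine is odd and cosine even, so
  only the even part of \<open>q\<close> contributes.\<close>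

lemma J_symmetric:
  assumes "0 \<le> s" "s < r" "0 < b"
  shows "2 * J b s = integral {- (pi / 2)..pi / 2}
    (\<lambda>\<theta>. (q (s * sin \<theta>) + q (- (s * sin \<theta>))) * cos \<theta> powr b)" (is "_ = integral ?I ?g")
    and "(\<lambda>\<theta>. (q (s * sin \<theta>) + q (- (s * sin \<theta>))) * cos \<theta> powr b) integrable_on {- (pi / 2)..pi / 2}"
proof -
  let ?f = "\<lambda>\<theta>. q (s * sin \<theta>) * cos \<theta> powr b"
  have i: "?f integrable_on ?I"
    by (rule integrable_continuous_real[OF J_integrand_cont[OF assms]])
  have i': "(\<lambda>\<theta>. ?f (- \<theta>)) integrable_on ?I"
    using Henstock_Kurzweil_Integration.integrable_reflect_real[where a = "- (pi / 2)" and b = "pi / 2" and f = ?f] i by simp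
  have "integral ?I (\<lambda>\<theta>. ?f (- \<theta>)) = J b s"
    using Henstock_Kurzweil_Integration.integral_reflect_real[where a = "- (pi / 2)" and b = "pi / 2" and f = ?f] by (simp add: J_def)
  then have "2 * J b s = integral ?I (\<lambda>\<theta>. ?f \<theta> + ?f (- \<theta>))"
    using integral_add[OF i i'] by (simp add: J_def)
  then show "2 * J b s = integral ?I ?g" by (simp add: distrib_right)
  show "?g integrable_on ?I"
    using integrable_add[OF i i'] by (simp add: distrib_right)
qed

text \<open>The symmetrised integrands compare pointwise: the even part of \<open>q\<close> depends
  on the absolute value of its argument and is nondecreasing in it.\<close>

lemma J_mono:
  assumes "0 \<le> s" "s \<le> t" "t < r" "0 < b"
  shows "J b s \<le> J b t"
proof -
  have "(q (s * sin x) + q (- (s * sin x))) \<le> (q (t * sin x) + q (- (t * sin x)))" for x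
  proof -
    have even: "q y + q (- y) = q \<bar>y\<bar> + q (- \<bar>y\<bar>)" for y by (simp add: abs_if)
    have "\<bar>s * sin x\<bar> \<le> \<bar>t * sin x\<bar>" using assms by (simp add: abs_mult mult_right_mono)
    moreover have "\<bar>t * sin x\<bar> < r" using scaled_sin_mem[of t x] assms by auto
    ultimately show ?thesis
      using q_even_part_mono[of "\<bar>s * sin x\<bar>" "\<bar>t * sin x\<bar>"] even[of "s * sin x"] even[of "t * sin x"]
      by simp
  qed
  then have "2 * J b s \<le> 2 * J b t"
    using assms by (simp only: J_symmetric(1)) (intro integral_le J_symmetric(2) mult_right_mono; simp)
  then show ?thesis by simp
qed

text \<open>The integrand is continuous, nonnegative and positive at \<theta> = 0.\<close>

lemma J_pos:
  assumes "0 \<le> s" "s < r" "0 < b"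
  shows "0 < J b s"
proof -
  let ?f = "\<lambda>\<theta>. q (s * sin \<theta>) * cos \<theta> powr b"
  have nonneg: "0 \<le> ?f x" for x
    using q_pos[OF scaled_sin_mem[OF assms(1,2)], of x] by simp
  have "integral {- (pi / 2)..pi / 2} ?f \<noteq> 0"
    using integral_eq_0_iff[OF J_integrand_cont[OF assms]] nonneg q_pos[OF scaled_sin_mem[OF assms(1,2)], of 0]
    by (auto dest: bspec[of _ _ 0])
  moreover have "0 \<le> J b s"
    unfolding J_def by (intro integral_nonneg integrable_continuous_real J_integrand_cont assms nonneg)
  ultimately show ?thesis by (simp add: J_def)
qed

subsection \<open>The period as a function of the energy\<close>

definition rate :: "real \<Rightarrow> real \<Rightarrow> real" where
  "rate p E = conj_exp p powr (- 1 / p) * E powr (1 / 2 - 1 / p)"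

definition clock_density :: "real \<Rightarrow> real \<Rightarrow> real \<Rightarrow> real" where
  "clock_density p E \<theta> = 2 * rate p E * (q (sqrt E * sin \<theta>) * cos \<theta> powr (1 - 2 / p))"

text \<open>The travel time from the left turning point to \<open>x\<close>, written in the angle
  with h(x) = sqrt E sin \<theta>. This replaces an integrand singular at the turning points by a
  continuous one.\<close>

definition clock :: "real \<Rightarrow> real \<Rightarrow> real \<Rightarrow> real" where
  "clock p E x = integral {- (pi / 2)..arcsin (h x / sqrt E)} (clock_density p E)"

lemma sqrt_energy:
  assumes "0 < E" "E < Estar"
  shows "0 < sqrt E" "sqrt E < r" "sqrt E \<in> {-r<..<r}" "- sqrt E \<in> {-r<..<r}"
proof -
  show "0 < sqrt E" "sqrt E < r" using assms by (simp_all add: r_def)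
  then show "sqrt E \<in> {-r<..<r}" "- sqrt E \<in> {-r<..<r}"
    by (auto simp only: greaterThanLessThan_iff)
qed

lemma h_between:
  assumes E: "0 < E" "E < Estar" and x: "\<xi> (- sqrt E) < x" "x < \<xi> (sqrt E)"
  shows "- sqrt E < h x" "h x < sqrt E" "x \<in> {0<..<B}"
proof -
  note s = sqrt_energy[OF E]
  show "x \<in> {0<..<B}" using \<xi>_mem[OF s(3)] \<xi>_mem[OF s(4)] x by auto
  show "- sqrt E < h x" "h x < sqrt E"
    using h_strict_mono[of "\<xi> (- sqrt E)" x] h_strict_mono[of x "\<xi> (sqrt E)"]
      h_\<xi>[of "sqrt E"] h_\<xi>[of "- sqrt E"] s \<xi>_mem[OF s(3)] \<xi>_mem[OF s(4)] x by auto
qed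

lemma clock_density_cont:
  assumes "p > 2" "0 < E" "E < Estar"
  shows "continuous_on {- (pi / 2)..pi / 2} (clock_density p E)"
  unfolding clock_density_def using sqrt_energy[OF assms(2,3)] assms(1)
  by (intro continuous_on_mult_left J_integrand_cont) (auto simp: field_simps)

text \<open>The fundamental theorem of calculus and the chain rule undo the substitution; the powers
  recombine because E (1 - z^2) = E - V(x) for z = h(x) / sqrt E.\<close>

lemma clock_at_inner:
  assumes p: "p > 2" and E: "0 < E" "E < Estar" and x: "\<xi> (- sqrt E) < x" "x < \<xi> (sqrt E)"
  shows "(clock p E has_real_derivative 1 / (conj_exp p * (E - V x)) powr (1 / p)) (at x)"
proof -
  note s = sqrt_energy[OF E] and hx = h_between[OF E x]
  define z where "z = h x / sqrt E"
  have z: "-1 < z" "z < 1"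
    using hx(1,2) s(1) by (simp_all add: z_def less_divide_eq divide_less_eq)
  then have "\<bar>z\<bar> < 1" by auto
  then have z2: "1 - z\<^sup>2 > 0" by (simp add: abs_square_less_1)
  have a: "- (pi / 2) < arcsin z" "arcsin z < pi / 2" using arcsin_lt_bounded[OF z] by auto
  have q: "q (h x) = sqrt (G x)" using \<xi>_h[of x] hx by (simp add: q_def)
  have Gx: "sqrt (G x) > 0" using G_pos[OF hx(3)] by simp
  have "((\<lambda>y. integral {- (pi / 2)..y} (clock_density p E)) has_real_derivative
      clock_density p E (arcsin z)) (at (arcsin z) within {- (pi / 2)..pi / 2})"
    by (rule integral_has_real_derivative[OF clock_density_cont[OF p E]]) (use a in simp)
  \<comment> \<open>The angle is interior to the interval, so the restricted derivative is a full
    one.\<close>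
  then have D1: "((\<lambda>y. integral {- (pi / 2)..y} (clock_density p E)) has_real_derivative
      clock_density p E (arcsin z)) (at (arcsin z))"
    using a at_within_interior[of "arcsin z" "{- (pi / 2)..pi / 2}"] by (simp only: interior_atLeastAtMost_real) simp
  have D2: "((\<lambda>x. h x / sqrt E) has_real_derivative 1 / (2 * sqrt (G x)) / sqrt E) (at x)"
    by (rule DERIV_cdivide[OF h_deriv[OF hx(3)]])
  have "((\<lambda>x. arcsin (h x / sqrt E)) has_real_derivative
      inverse (sqrt (1 - z\<^sup>2)) * (1 / (2 * sqrt (G x)) / sqrt E)) (at x)"
    using DERIV_arcsin[OF z] unfolding z_def
    by (rule DERIV_chain2[where f = arcsin and g = "\<lambda>x. h x / sqrt E", OF _ D2])
  with D1 have "(clock p E has_real_derivative clock_density p E (arcsin z) *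
      (inverse (sqrt (1 - z\<^sup>2)) * (1 / (2 * sqrt (G x)) / sqrt E))) (at x)"
    unfolding clock_def[abs_def] z_def
    by (rule DERIV_chain2[where f = "\<lambda>y. integral {- (pi / 2)..y} (clock_density p E)"])
  moreover have "clock_density p E (arcsin z) *
      (inverse (sqrt (1 - z\<^sup>2)) * (1 / (2 * sqrt (G x)) / sqrt E))
      = 1 / (conj_exp p * (E - V x)) powr (1 / p)"
  proof -
    have "clock_density p E (arcsin z) = 2 * rate p E * (sqrt (G x) * sqrt (1 - z\<^sup>2) powr (1 - 2 / p))"
      using z s q by (simp add: clock_density_def cos_arcsin z_def)
    then have "clock_density p E (arcsin z) * (inverse (sqrt (1 - z\<^sup>2)) * (1 / (2 * sqrt (G x)) / sqrt E))
      = rate p E / sqrt E * (sqrt (1 - z\<^sup>2) powr (1 - 2 / p) / sqrt (1 - z\<^sup>2))"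
      using Gx by (simp add: field_simps)
    also have "sqrt (1 - z\<^sup>2) powr (1 - 2 / p) / sqrt (1 - z\<^sup>2) = (1 - z\<^sup>2) powr (- 1 / p)"
    proof -
      have "sqrt (1 - z\<^sup>2) powr (1 - 2 / p) / sqrt (1 - z\<^sup>2) = sqrt (1 - z\<^sup>2) powr (1 - 2 / p - 1)"
        using z2 by (subst powr_diff) simp
      also have "\<dots> = ((1 - z\<^sup>2) powr (1 / 2)) powr (- 2 / p)"
        using z2 by (simp add: powr_half_sqrt)
      also have "\<dots> = (1 - z\<^sup>2) powr (- 1 / p)"
        by (simp add: powr_powr)
      finally show ?thesis .
    qed
    also have "rate p E / sqrt E = (conj_exp p * E) powr (- 1 / p)"
    proof -
      have "E powr (1 / 2 - 1 / p) / sqrt E = E powr (- 1 / p)"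
        using powr_diff[of E "1 / 2 - 1 / p" "1 / 2"] powr_half_sqrt[of E] E by simp
      then have "rate p E / sqrt E = conj_exp p powr (- 1 / p) * E powr (- 1 / p)"
        by (simp add: rate_def flip: times_divide_eq_right)
      then show ?thesis
        using p E conj_exp_pos[of p] by (simp add: powr_mult)
    qed
    also have "(conj_exp p * E) powr (- 1 / p) * (1 - z\<^sup>2) powr (- 1 / p)
      = (conj_exp p * E * (1 - z\<^sup>2)) powr (- 1 / p)"
      using p E conj_exp_pos[of p] z2 by (simp add: powr_mult)
    also have "E * (1 - z\<^sup>2) = E - V x"
      using h_square[of x] hx E by (simp add: z_def power_divide field_simps)
    then have "conj_exp p * E * (1 - z\<^sup>2) = conj_exp p * (E - V x)" by (simp add: mult.assoc)
    finally show ?thesis by (simp add: powr_minus_divide)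
  qed
  ultimately show ?thesis by (simp only:)
qed

lemma time_map_clock:
  assumes p: "p > 2" and E: "0 < E" "E < Estar"
  shows "time_map p E (\<xi> (- sqrt E)) (\<xi> (sqrt E)) V (clock p E)"
proof
  note s = sqrt_energy[OF E]
  let ?w1 = "\<xi> (- sqrt E)" and ?w2 = "\<xi> (sqrt E)"
  have lt: "?w1 < A" "A < ?w2" "0 < ?w1" "?w2 < B"
    using \<xi>_strict_mono[of "- sqrt E" 0] \<xi>_strict_mono[of 0 "sqrt E"] s \<xi>_0
      \<xi>_mem[OF s(3)] \<xi>_mem[OF s(4)] by auto
  show "p > 1" using p by simp
  show "?w1 < ?w2" using lt by simp
  show "V ?w1 = E" "V ?w2 = E" using V_\<xi> s E by simp_all
  show "deriv V ?w1 < 0" "0 < deriv V ?w2" using dV_neg dV_pos lt by auto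
  show "(V has_real_derivative deriv V x) (at x)" "isCont (deriv V) x" for x
    by (rule V_deriv dV_cont)+
  show "V x < E" if "?w1 < x" "x < ?w2" for x
  proof -
    have "\<bar>h x\<bar> < sqrt E" using h_between[OF E that] by auto
    then have "(h x)\<^sup>2 < (sqrt E)\<^sup>2" using s by (metis abs_le_square_iff abs_of_pos not_le)
    then show ?thesis using h_square[of x] h_between(3)[OF E that] E by auto
  qed
  show "(clock p E has_real_derivative 1 / (conj_exp p * (E - V x)) powr (1 / p)) (at x)"
    if "?w1 < x" "x < ?w2" for x
    by (rule clock_at_inner[OF p E that])
  have hz: "h x / sqrt E \<in> {-1..1}" if "x \<in> {?w1..?w2}" for x
  proof (cases "x = ?w1 \<or> x = ?w2")
    case True
    then show ?thesis using h_\<xi>[of "sqrt E"] h_\<xi>[of "- sqrt E"] s by auto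
  next
    case False
    then have "?w1 < x" "x < ?w2" using that by auto
    from h_between(1,2)[OF E this] s(1) show ?thesis
      by (simp add: le_divide_eq divide_le_eq)
  qed
  show "continuous_on {?w1..?w2} (clock p E)"
    unfolding clock_def[abs_def]
  proof (rule continuous_on_compose2[where g = "\<lambda>y. integral {- (pi / 2)..y} (clock_density p E)"])
    show "continuous_on {- (pi / 2)..pi / 2} (\<lambda>y. integral {- (pi / 2)..y} (clock_density p E))"
      by (intro indefinite_integral_continuous_1 integrable_continuous_real clock_density_cont assms)
    show "continuous_on {?w1..?w2} (\<lambda>x. arcsin (h x / sqrt E))"
      using hz s by (intro continuous_intros h_cont_on) auto
    show "(\<lambda>x. arcsin (h x / sqrt E)) ` {?w1..?w2} \<subseteq> {- (pi / 2)..pi / 2}"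
      using hz arcsin_bounded by auto
  qed
qed

lemma clock_ends:
  assumes "0 < E" "E < Estar"
  shows "clock p E (\<xi> (- sqrt E)) = 0"
    and "clock p E (\<xi> (sqrt E)) = 2 * rate p E * J (1 - 2 / p) (sqrt E)"
  using h_\<xi>[of "sqrt E"] h_\<xi>[of "- sqrt E"] sqrt_energy[OF assms]
  by (simp_all add: clock_def clock_density_def[abs_def] J_def)

text \<open>The description in \<open>min_period\<close> is proper: \<open>orbit\<close> provides
  existence, and every competing solution has the same range and hence the minimal period
  \<open>2 * L\<close>.\<close>

lemma min_period_eq:
  assumes p: "p > 2" and E: "0 < E" "E < Estar"
  shows "min_period p V A B E = 4 * rate p E * J (1 - 2 / p) (sqrt E)"
proof -
  note s = sqrt_energy[OF E]
  let ?w1 = "\<xi> (- sqrt E)" and ?w2 = "\<xi> (sqrt E)"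
  interpret time_map p E ?w1 ?w2 V "clock p E"
    by (rule time_map_clock[OF assms])
  have lt: "?w1 < A" "A < ?w2" "0 < ?w1" "?w2 < B"
    using \<xi>_strict_mono[of "- sqrt E" 0] \<xi>_strict_mono[of 0 "sqrt E"] s \<xi>_0
      \<xi>_mem[OF s(3)] \<xi>_mem[OF s(4)] by auto
  have T: "2 * L = 4 * rate p E * J (1 - 2 / p) (sqrt E)"
    by (simp add: L_def clock_ends[OF E])
  \<comment> \<open>The well determines its turning points: h takes the values -sqrt E and sqrt E
    there, and \<xi> inverts it.\<close>
  have ends: "u = ?w1 \<and> v = ?w2" if "0 < u" "u < A" "A < v" "v < B" "V u = E" "V v = E" for u v
  proof -
    have "h u = - sqrt E" "h v = sqrt E" using that by (simp_all add: h_def)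
    then show ?thesis using that \<xi>_h[of u] \<xi>_h[of v] by simp
  qed
  show ?thesis
    unfolding min_period_def T[symmetric]
  proof (rule the_equality)
    have "oscillates_in_well V A B E orbit"
      unfolding oscillates_in_well_def
      by (intro exI[of _ ?w1] exI[of _ ?w2] conjI ballI lt V_ends orbit_range V_less) auto
    moreover have "0 < orbit t" for t using orbit_mem[of t] lt by auto
    ultimately show "\<exists>w. plaplace_solution p V w \<and> has_energy p V w E \<and> (\<forall>t. 0 < w t) \<and>
        oscillates_in_well V A B E w \<and> is_minimal_period w (2 * L)"
      using orbit_solution orbit_energy solution_minimal_period[OF orbit_solution orbit_energy orbit_range]
      by (intro exI[of _ orbit] conjI allI)
  next
    fix T
    assume "\<exists>w. plaplace_solution p V w \<and> has_energy p V w E \<and> (\<forall>t. 0 < w t) \<and>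
        oscillates_in_well V A B E w \<and> is_minimal_period w T"
    then obtain w where w: "plaplace_solution p V w" "has_energy p V w E"
      "oscillates_in_well V A B E w" "is_minimal_period w T" by blast
    from w(3) obtain u v where "0 < u" "u < A" "A < v" "v < B" "V u = E" "V v = E"
      and ran: "range w = {u..v}"
      unfolding oscillates_in_well_def by blast
    from ends[OF this(1-6)] ran have "range w = {?w1..?w2}" by simp
    \<comment> \<open>Two minimal periods of one function bound each other.\<close>
    from solution_minimal_period[OF w(1,2) this] w(4) show "T = 2 * L"
      by (auto simp: is_minimal_period_def intro: antisym)
  qed
qed

text \<open>Strictness comes from \<open>rate\<close>, whose exponent 1/2 - 1/p is positive; it
  survives multiplication by the positive, nondecreasing \<open>J\<close>.\<close>

lemma min_period_strict_mono:
  assumes p: "p > 2"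
  shows "strict_mono_on {0<..<Estar} (min_period p V A B)"
proof (rule strict_mono_onI)
  fix E F assume EF: "E \<in> {0<..<Estar}" "F \<in> {0<..<Estar}" "E < F"
  have b: "0 < 1 - 2 / p" using p by simp
  have "J (1 - 2 / p) (sqrt E) \<le> J (1 - 2 / p) (sqrt F)"
    using EF sqrt_energy[of E] sqrt_energy[of F] b by (intro J_mono) auto
  moreover have "0 < J (1 - 2 / p) (sqrt E)"
    using EF sqrt_energy[of E] b by (intro J_pos) auto
  moreover have "E powr (1 / 2 - 1 / p) < F powr (1 / 2 - 1 / p)"
    using EF p by (intro powr_less_mono2) auto
  then have "rate p E < rate p F" "0 < rate p E"
    using EF p conj_exp_pos[of p] by (auto simp: rate_def)
  ultimately have "rate p E * J (1 - 2 / p) (sqrt E) < rate p F * J (1 - 2 / p) (sqrt F)"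
    by (intro mult_less_le_imp_less) auto
  then show "min_period p V A B E < min_period p V A B F"
    using EF p by (simp add: min_period_eq)
qed

end

theorem theorem1p2:
  fixes p A B Estar :: real and V :: "real \<Rightarrow> real"
  assumes "p > 2"
    and "Ck_on 2 V UNIV"
    and "0 < A" and "A < B" and "0 < Estar"
    and "V 0 = Estar" and "V B = Estar"
    and "deriv V 0 = 0" and "V A = 0" and "deriv V A = 0"
    and "deriv (deriv V) A > 0"
    and "\<forall>w \<in> {0<..<A} \<union> {A<..<B}. 0 < V w \<and> V w < Estar"
    and "Ck_on 3 V {0<..}"
    and "\<forall>w \<in> {0<..<A} \<union> {A<..<B}. deriv V w \<noteq> 0"
    and "convex_on {0<..<B}
           (\<lambda>w. if w = A then 1 / (2 * deriv (deriv V) A) else V w / (deriv V w)\<^sup>2)"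
  shows "strict_mono_on {0<..<Estar} (\<lambda>E. min_period p V A B E)"
proof -
  have "(deriv ^^ j) V field_differentiable at x" if "j < 2" for j x
    using assms(2) that by (simp add: Ck_on_def)
  from this[of 0] this[of 1] have "V field_differentiable at x" "deriv V field_differentiable at x" for x
    by simp_all
  then interpret potential_well V A B Estar
    using assms by unfold_locales (auto simp: DERIV_deriv_iff_field_differentiable)
  show ?thesis using min_period_strict_mono[OF assms(1)] .
qed

end
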